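(* Let $G$ be a group, let $RG$ be its group algebra, and let $\widetilde{RG}$ be the vector space of formal linear combinations of words. Let $A$ be an Abelian group. Then type $n$ invariants on $\widetilde{RG}$ factor through $\widetilde{RG}$, by way of the subword map $s$, with the factorization vanishing on words of $\widetilde{RG}$ of length greater than $n$. That is, for every $A$-valued type $n$ invariant $\nu:\widetilde{RG}\to A$ there is a function $\omega:\widetilde{RG}\to A$ such that $\nu=\omega\circ s$ and $\omega(w)=0$ for every word $w$ of length greater than $n$.
   Context: $RG$ is the group algebra generated by the elements of $G$, with coefficients $R$. $\widetilde{RG}$ is the vector space of formal linear combinations, with coefficients in $R$, of words $g_{j_1}g_{j_2}\cdots g_{j_m}$ in elements of $G$. Non-reduced words are included: $gg^{-1}$ and $1$ (the word with no letters) are the same element of $RG$ but different elements of $\widetilde{RG}$. Words are multiplied by concatenation, extended linearly. A subword of a word is the word obtained by keeping some subset of its letters, in order, and deleting the others. The linear map $s:\widetilde{RG}\to\widetilde{RG}$ sends a word to the sum of all its subwords (one summand for each subset of letter positions). An invariant on $\widetilde{RG}$ is a function on $\widetilde{RG}$ whose value depends only on the element of $RG$ that is represented. It is of type $n$ if it vanishes on words containing greater than $n$ products of the form $(g-1)$, i.e. on products in which more than $n$ of the factors are of the form $(g-1)$. *)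

theory Defs
  imports "HOL-Library.Poly_Mapping"
begin

text \<open>
  The product on \<open>'b \<Rightarrow>\<^sub>0 'r\<close> is convolution with
  respect to the additively written, not necessarily commutative, monoid \<open>'b\<close>; hence \<open>'b \<Rightarrow>\<^sub>0 'r\<close>
  is the monoid algebra of \<open>'b\<close> over \<open>'r\<close>.  Class \<open>group_add\<close> is the class of arbitrary groups:
  \<open>+\<close> is the group operation and \<open>0\<close> is the neutral element.  The group algebra \<open>RG\<close> is
  therefore \<open>'g \<Rightarrow>\<^sub>0 'r\<close> with \<open>'g :: group_add\<close> and \<open>'r :: comm_ring_1\<close>.
\<close>

text \<open>
  Words are unreduced: the empty word \<open>0\<close> and the one-letter word \<open>Word [0]\<close>, whose letter
  is the neutral element of the group, are different.
\<close>

datatype 'g word = Word (letters: "'g list")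

instantiation word :: (type) monoid_add
begin

definition zero_word :: "'a word" where
  "zero_word = Word []"

definition plus_word :: "'a word \<Rightarrow> 'a word \<Rightarrow> 'a word" where
  "plus_word v w = Word (letters v @ letters w)"

instance
  by standard (simp_all add: zero_word_def plus_word_def)

end

text \<open>
  With concatenation as the monoid operation, \<open>('g, 'r) word_algebra\<close> is the algebra of formal
  linear combinations of words.  Its unit \<open>1\<close> is the empty word.
\<close>

type_synonym ('g, 'r) word_algebra = "'g word \<Rightarrow>\<^sub>0 'r"

definition of_word :: "'g word \<Rightarrow> ('g, 'r::comm_ring_1) word_algebra" where
  "of_word w = Poly_Mapping.single w 1"

definition lin_ext :: "('b \<Rightarrow> ('c \<Rightarrow>\<^sub>0 'r)) \<Rightarrow> ('b \<Rightarrow>\<^sub>0 'r) \<Rightarrow> ('c \<Rightarrow>\<^sub>0 'r::comm_ring_1)" where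
  "lin_ext f x =
     (\<Sum>b\<in>Poly_Mapping.keys x. Poly_Mapping.map ((*) (Poly_Mapping.lookup x b)) (f b))"

text \<open>The element of \<open>RG\<close> represented by a formal linear combination of words.\<close>

definition represented :: "('g::group_add, 'r::comm_ring_1) word_algebra \<Rightarrow> ('g \<Rightarrow>\<^sub>0 'r)" where
  "represented = lin_ext (\<lambda>w. Poly_Mapping.single (sum_list (letters w)) 1)"

text \<open>
  The sum ranges over the sets of letter positions, so subwords are counted with multiplicity.
\<close>

definition subword_map ::
    "('g, 'r::comm_ring_1) word_algebra \<Rightarrow> ('g, 'r) word_algebra" where
  "subword_map =
     lin_ext (\<lambda>w. \<Sum>I\<in>Pow {..<length (letters w)}. of_word (Word (nths (letters w) I)))"

definition invariant ::
    "(('g::group_add, 'r::comm_ring_1) word_algebra \<Rightarrow> 'a) \<Rightarrow> bool" where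
  "invariant \<nu> \<longleftrightarrow> (\<forall>x y. represented x = represented y \<longrightarrow> \<nu> x = \<nu> y)"

definition letter :: "'g \<Rightarrow> ('g, 'r::comm_ring_1) word_algebra" where
  "letter g = of_word (Word [g])"

definition differences :: "('g, 'r::comm_ring_1) word_algebra set" where
  "differences = range (\<lambda>g. letter g - 1)"

text \<open>
  A word containing more than \<open>n\<close> products of the form \<open>g - 1\<close> is a product, in any order, of
  factors \<open>g\<close> and factors \<open>g - 1\<close>, more than \<open>n\<close> of them of the latter kind.
  (The two kinds are disjoint, since the coefficient of \<open>g - 1\<close> at the empty word is \<open>-1\<close>.)
\<close>

definition type_n_invariant ::
    "nat \<Rightarrow> (('g::group_add, 'r::comm_ring_1) word_algebra \<Rightarrow> 'a::ab_group_add) \<Rightarrow> bool" where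
  "type_n_invariant n \<nu> \<longleftrightarrow>
     invariant \<nu> \<and>
     (\<forall>fs. set fs \<subseteq> range letter \<union> differences \<longrightarrow>
           n < length (filter (\<lambda>f. f \<in> differences) fs) \<longrightarrow>
           \<nu> (prod_list fs) = 0)"

end

theory Submission
  imports Defs
begin

text \<open>
  The subword map is the algebra endomorphism sending each letter \<open>g\<close> to \<open>g + 1\<close>, so
  it is inverted by the endomorphism sending \<open>g\<close> to \<open>g - 1\<close>.  Composing \<open>\<nu>\<close> with this inverse gives
  \<open>\<omega>\<close>: its value on a word of length \<open>m\<close> is the value of \<open>\<nu>\<close> on a product of \<open>m\<close> differences, which
  vanishes for \<open>m > n\<close>.
\<close>

lemma lookup_map_times:
  fixes p :: "'b \<Rightarrow>\<^sub>0 'r::comm_ring_1"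
  shows "Poly_Mapping.lookup (Poly_Mapping.map ((*) c) p) k = c * Poly_Mapping.lookup p k"
  by (simp add: Poly_Mapping.map.rep_eq when_def)

lemma lookup_lin_ext:
  "Poly_Mapping.lookup (lin_ext f x) k =
     (\<Sum>b\<in>Poly_Mapping.keys x. Poly_Mapping.lookup x b * Poly_Mapping.lookup (f b) k)"
  by (simp add: lin_ext_def lookup_sum lookup_map_times)

text \<open>Keys outside \<open>Poly_Mapping.keys x\<close> contribute zero. Cancellation can shrink
  the key set of a sum or of a scalar multiple, so linearity is checked by evaluating both sides
  over one common finite set \<open>B\<close>.\<close>

lemma lookup_lin_ext_superset:
  assumes "finite B" "Poly_Mapping.keys x \<subseteq> B"
  shows "Poly_Mapping.lookup (lin_ext f x) k =
     (\<Sum>b\<in>B. Poly_Mapping.lookup x b * Poly_Mapping.lookup (f b) k)"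
  unfolding lookup_lin_ext using assms
  by (intro sum.mono_neutral_left) (auto simp: in_keys_iff)

lemma lin_ext_add: "lin_ext f (x + y) = lin_ext f x + lin_ext f y"
proof (rule poly_mapping_eqI)
  fix k
  let ?B = "Poly_Mapping.keys x \<union> Poly_Mapping.keys y"
  have "finite ?B" "Poly_Mapping.keys (x + y) \<subseteq> ?B"
    using Poly_Mapping.keys_add[of x y] by auto
  then show "Poly_Mapping.lookup (lin_ext f (x + y)) k =
      Poly_Mapping.lookup (lin_ext f x + lin_ext f y) k"
    by (simp add: lookup_lin_ext_superset[of ?B] lookup_add distrib_right sum.distrib)
qed

lemma lin_ext_sum: "lin_ext f (\<Sum>i\<in>A. g i) = (\<Sum>i\<in>A. lin_ext f (g i))"
  using sum_comp_morphism[of "lin_ext f" g A]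
  by (simp add: lin_ext_add lin_ext_def[of f 0] o_def)

lemma lin_ext_map_times:
  "lin_ext f (Poly_Mapping.map ((*) c) x) = Poly_Mapping.map ((*) c) (lin_ext f x)"
proof (rule poly_mapping_eqI)
  fix k
  have "Poly_Mapping.keys (Poly_Mapping.map ((*) c) x) \<subseteq> Poly_Mapping.keys x"
    by (auto simp: in_keys_iff lookup_map_times)
  then show "Poly_Mapping.lookup (lin_ext f (Poly_Mapping.map ((*) c) x)) k =
      Poly_Mapping.lookup (Poly_Mapping.map ((*) c) (lin_ext f x)) k"
    by (simp add: lookup_lin_ext_superset[of "Poly_Mapping.keys x"] lookup_map_times
        sum_distrib_left mult.assoc)
qed

lemma lin_ext_of_word: "lin_ext f (of_word w) = f w"
  by (rule poly_mapping_eqI)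
    (simp add: of_word_def lookup_lin_ext_superset[of "{w}"])

lemma lin_ext_lin_ext: "lin_ext f (lin_ext g x) = lin_ext (\<lambda>b. lin_ext f (g b)) x"
  by (simp add: lin_ext_def[of g] lin_ext_def[of "\<lambda>b. lin_ext f (g b)"]
      lin_ext_sum lin_ext_map_times)

lemma lin_ext_word_basis: "lin_ext of_word x = x"
  by (rule poly_mapping_eqI)
    (simp add: lookup_lin_ext of_word_def lookup_single when_def in_keys_iff
      if_distrib[where f = "(*) _"] cong: if_cong)

text \<open>Distributivity: expanding the right side means choosing \<open>P x\<close> or
  \<open>1\<close> at each position, and \<open>I\<close> records where \<open>P x\<close> is
  chosen. The order of the factors is kept, so commutativity plays no part.\<close>

lemma sum_prod_list_nths:
  fixes P :: "'b \<Rightarrow> 'c::semiring_1"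
  shows "(\<Sum>I\<in>Pow {..<length xs}. prod_list (map P (nths xs I))) =
    prod_list (map (\<lambda>x. P x + 1) xs)"
proof (induction xs)
  case Nil
  then show ?case by simp
next
  case (Cons x xs)
  let ?S = "Pow {..<length xs}"
  let ?F = "\<lambda>I. prod_list (map P (nths (x # xs) I))"
  \<comment> \<open>Position sets are split by whether they contain \<open>0\<close>, the position
    of \<open>x\<close>; \<open>Suc\<close> shifts positions of \<open>xs\<close> to positions of
    \<open>x # xs\<close>. The two halves yield the summands \<open>1\<close> and \<open>P x\<close>
    of the first factor.\<close>
  have Pow_eq: "Pow {..<length (x # xs)} = image Suc ` ?S \<union> (\<lambda>I. insert 0 (Suc ` I)) ` ?S"
    by (simp add: lessThan_Suc_eq_insert_0 Pow_insert image_Pow_surj[OF refl, symmetric]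
        image_image)
  have inj0: "inj_on (image Suc) ?S"
    by (rule inj_onI) (simp add: inj_image_eq_iff)
  have inj1: "inj_on (\<lambda>I. insert 0 (Suc ` I)) ?S"
  proof (rule inj_onI)
    fix I J assume "insert 0 (Suc ` I) = insert 0 (Suc ` J)"
    then have "Suc ` I = Suc ` J"
      by (subst (asm) insert_ident) auto
    then show "I = J"
      by (simp add: inj_image_eq_iff)
  qed
  have "sum ?F (Pow {..<length (x # xs)}) =
      sum ?F (image Suc ` ?S) + sum ?F ((\<lambda>I. insert 0 (Suc ` I)) ` ?S)"
    unfolding Pow_eq by (rule sum.union_disjoint) auto
  also have "sum ?F (image Suc ` ?S) = (\<Sum>I\<in>?S. prod_list (map P (nths xs I)))"
    by (simp add: sum.reindex[OF inj0] nths_Cons image_iff)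
  also have "sum ?F ((\<lambda>I. insert 0 (Suc ` I)) ` ?S) =
      P x * (\<Sum>I\<in>?S. prod_list (map P (nths xs I)))"
    by (simp add: sum.reindex[OF inj1] nths_Cons image_iff sum_distrib_left)
  finally show ?case
    by (simp add: Cons.IH distrib_right add.commute)
qed

lemma prod_list_letters: "prod_list (map letter gs) = of_word (Word gs)"
  by (induction gs)
    (simp_all add: letter_def of_word_def mult_single plus_word_def
      flip: zero_word_def)

text \<open>Prescribed on the basis of words, so that composition with \<open>subword_map\<close>
  can be computed one word at a time by \<open>lin_ext_lin_ext\<close>.\<close>

definition difference_map ::
    "('g, 'r::comm_ring_1) word_algebra \<Rightarrow> ('g, 'r) word_algebra" where
  "difference_map = lin_ext (\<lambda>w. prod_list (map (\<lambda>g. letter g - 1) (letters w)))"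

text \<open>On a single word, \<open>sum_prod_list_nths\<close> with
  \<open>P g = letter g - 1\<close> gives the product of the factors
  \<open>(letter g - 1) + 1 = letter g\<close>, which is the word itself.\<close>

lemma difference_map_subword_map: "difference_map (subword_map x) = x"
  by (simp add: difference_map_def subword_map_def lin_ext_lin_ext lin_ext_sum
      lin_ext_of_word sum_prod_list_nths prod_list_letters lin_ext_word_basis)

theorem theorem3p1:
  fixes \<nu> :: "('g::group_add, 'r::comm_ring_1) word_algebra \<Rightarrow> 'a::ab_group_add"
    and n :: nat
  assumes "type_n_invariant n \<nu>"
  shows "\<exists>\<omega> :: ('g, 'r) word_algebra \<Rightarrow> 'a.
           \<nu> = \<omega> \<circ> subword_map \<and>
           (\<forall>w. n < length (letters w) \<longrightarrow> \<omega> (of_word w) = 0)"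
proof (intro exI conjI allI impI)
  show "\<nu> = (\<nu> \<circ> difference_map) \<circ> subword_map"
    by (simp add: fun_eq_iff difference_map_subword_map)
next
  fix w :: "'g word"
  assume "n < length (letters w)"
  define fs where "fs = map (\<lambda>g. letter g - 1 :: ('g, 'r) word_algebra) (letters w)"
  have "set fs \<subseteq> differences"
    by (auto simp: fs_def differences_def)
  \<comment> \<open>Every factor is a difference, so the number counted by the type \<open>n\<close>
    condition is the full length of \<open>w\<close>.\<close>
  then have "filter (\<lambda>f. f \<in> differences) fs = fs"
    by (auto intro: filter_True)
  with \<open>n < length (letters w)\<close>
  have "n < length (filter (\<lambda>f. f \<in> differences) fs)"
    by (simp add: fs_def)
  with assms \<open>set fs \<subseteq> differences\<close> have "\<nu> (prod_list fs) = 0"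
    unfolding type_n_invariant_def by blast
  then show "(\<nu> \<circ> difference_map) (of_word w) = 0"
    by (simp add: difference_map_def lin_ext_of_word fs_def)
qed

end
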